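(* For all integers $n\geqslant 0$ and $r\geqslant 1$, $$\sum_{k=0}^{\infty}p\left( n-P(r+2,-k)\right) =S_r(n)+G_r(n),$$ where $P(s,m)=\dfrac{m^2(s-2)-m(s-4)}{2}$, so that $P(r+2,-k)=\dfrac{rk^2+(r-2)k}{2}$.
   Context: $p(m)$ denotes the number of integer partitions of $m$, with $p(0)=1$ and $p(m)=0$ for $m<0$. For a partition $\lambda$ and $r\geqslant 1$, $g_r(\lambda)$ is the smallest positive integer whose multiplicity as a part of $\lambda$ is less than $r$ (multiplicity $0$ allowed); by convention $g_0(\lambda)=\infty$. $S_r(n)=\sum_{\lambda\vdash n} g_r(\lambda)$. $G_r(n)$ is the number of partitions $\lambda$ of $n$ with $g_r(\lambda)<g_{r-1}(\lambda)$ (so $G_1(n)=p(n)$). *)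

theory Defs
  imports Complex_Main "HOL-Library.Multiset" "HOL-Library.Extended_Nat"
begin

definition partitions :: "nat \<Rightarrow> nat multiset set" where
  "partitions n = {\<mu>. 0 \<notin># \<mu> \<and> sum_mset \<mu> = n}"

definition num_partitions :: "int \<Rightarrow> nat" where
  "num_partitions m = (if m < 0 then 0 else card (partitions (nat m)))"

definition gap :: "nat \<Rightarrow> nat multiset \<Rightarrow> enat" where
  "gap r \<mu> = (if r = 0 then \<infinity> else enat (LEAST i. 0 < i \<and> count \<mu> i < r))"

text \<open>Only used for \<open>r \<ge> 1\<close>, where \<open>gap r \<mu>\<close> is finite; see \<open>enat_gap_sum\<close> below.\<close>
definition gap_sum :: "nat \<Rightarrow> nat \<Rightarrow> nat" where
  "gap_sum r n = (\<Sum>\<mu>\<in>partitions n. the_enat (gap r \<mu>))"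

definition gap_drop :: "nat \<Rightarrow> nat \<Rightarrow> nat" where
  "gap_drop r n = card {\<mu> \<in> partitions n. gap r \<mu> < gap (r - 1) \<mu>}"

text \<open>The numerator is always even (\<open>two_times_polygonal\<close> below), so the integer division is exact.\<close>
definition polygonal :: "int \<Rightarrow> int \<Rightarrow> int" where
  "polygonal s m = (m^2 * (s - 2) - m * (s - 4)) div 2"

lemma two_times_polygonal: "2 * polygonal s m = m^2 * (s - 2) - m * (s - 4)"
proof -
  have "m^2 * (s - 2) - m * (s - 4) = s * (m * (m - 1)) + 2 * (2 * m - m^2)"
    by (simp add: algebra_simps power2_eq_square)
  moreover have "even (m * (m - 1))" by simp
  ultimately have "even (m^2 * (s - 2) - m * (s - 4))" by simp
  then show ?thesis unfolding polygonal_def by simp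
qed

lemma finite_partitions: "finite (partitions n)"
proof (rule finite_subset)
  show "partitions n \<subseteq> mset ` {xs. set xs \<subseteq> {..n} \<and> length xs \<le> n}"
  proof
    fix M assume M: "M \<in> partitions n"
    obtain xs where xs: "M = mset xs" by (metis ex_mset)
    from M have s: "sum_list xs = n" and z: "0 \<notin> set xs"
      by (auto simp: partitions_def xs sum_mset_sum_list)
    have "length xs \<le> sum_list xs" using z
      by (induction xs) (auto simp: Suc_le_eq)
    moreover have "set xs \<subseteq> {..n}" using s member_le_sum_list by fastforce
    ultimately show "M \<in> mset ` {xs. set xs \<subseteq> {..n} \<and> length xs \<le> n}"
      using s xs by auto
  qed
  show "finite (mset ` {xs. set xs \<subseteq> {..n} \<and> length xs \<le> n})"
    by (intro finite_imageI finite_lists_length_le) simp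
qed

lemma gap_exists:
  fixes \<mu> :: "nat multiset"
  assumes "r \<ge> 1"
  shows "\<exists>i>0. count \<mu> i < r"
proof -
  obtain i where "i \<notin> insert 0 (set_mset \<mu>)"
    using ex_new_if_finite[OF infinite_UNIV_nat, of "insert 0 (set_mset \<mu>)"] by auto
  then have "i > 0" "count \<mu> i = 0" by (auto simp: not_in_iff)
  with assms show ?thesis by auto
qed

lemma enat_gap_sum:
  assumes "r \<ge> 1"
  shows "enat (gap_sum r n) = (\<Sum>\<mu>\<in>partitions n. gap r \<mu>)"
proof -
  have "enat (\<Sum>\<mu>\<in>A. f \<mu>) = (\<Sum>\<mu>\<in>A. enat (f \<mu>))"
    for A :: "nat multiset set" and f
    by (induction A rule: infinite_finite_induct) (auto simp: zero_enat_def simp flip: plus_enat_simps(1))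
  with assms show ?thesis by (simp add: gap_sum_def gap_def)
qed

end

theory Submission
  imports Defs
begin

text \<open>Removing one copy of \<open>k\<close> from the multiset with \<open>r\<close> copies of each of \<open>1, \<dots>, k\<close> leaves
  a multiset (\<open>trimmed_staircase r k\<close>) of sum \<open>P(r + 2, -k)\<close>, so the \<open>k\<close>-th summand counts the
  partitions of \<open>n\<close> that contain it. A partition \<open>\<mu>\<close> contains it for all \<open>k < g\<^sub>r(\<mu>)\<close>, for
  \<open>k = g\<^sub>r(\<mu>)\<close> iff \<open>g\<^sub>r(\<mu>) < g\<^bsub>r-1\<^esub>(\<mu>)\<close>, and for no larger \<open>k\<close>. Summing over \<open>\<mu>\<close> first
  gives the right-hand side.\<close>

definition staircase :: "nat \<Rightarrow> nat \<Rightarrow> nat multiset" where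
  "staircase r k = (\<Sum>i\<in>{1..k}. replicate_mset r i)"

text \<open>At \<open>k = 0\<close> the staircase is empty and so is the truncated difference,
  matching the polygonal value 0.\<close>

definition trimmed_staircase :: "nat \<Rightarrow> nat \<Rightarrow> nat multiset" where
  "trimmed_staircase r k = staircase r k - {#k#}"

lemma count_staircase: "count (staircase r k) i = (if 1 \<le> i \<and> i \<le> k then r else 0)"
  by (auto simp: staircase_def count_sum sum.delta)

lemma double_sum_staircase: "2 * sum_mset (staircase r k) = r * (k * (k + 1))"
  by (induction k) (simp_all add: staircase_def algebra_simps sum_mset_replicate_mset)

text \<open>Doubling, and keeping \<open>2 * k\<close> on the left, avoids division and truncated
  subtraction.\<close>

lemma double_sum_trimmed_staircase:
  assumes "r \<ge> 1"
  shows "2 * sum_mset (trimmed_staircase r k) + 2 * k = r * (k * (k + 1))"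
proof (cases "k = 0")
  case True
  then show ?thesis by (simp add: trimmed_staircase_def staircase_def)
next
  case False
  with assms have "k \<in># staircase r k"
    by (intro count_inI) (simp add: count_staircase)
  then obtain M where "staircase r k = add_mset k M"
    by (blast dest: multi_member_split)
  then show ?thesis
    using double_sum_staircase[of r k] by (simp add: trimmed_staircase_def)
qed

lemma sum_trimmed_staircase:
  assumes "r \<ge> 1"
  shows "int (sum_mset (trimmed_staircase r k)) = polygonal (int r + 2) (- int k)"
proof -
  have "2 * int (sum_mset (trimmed_staircase r k)) + 2 * int k = int r * (int k * (int k + 1))"
    using double_sum_trimmed_staircase[OF assms, of k]
    by (metis of_nat_1 of_nat_add of_nat_mult of_nat_numeral)
  \<comment> \<open>At \<open>s = r + 2\<close>, \<open>m = - k\<close> the numerator is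
    \<open>r * k^2 + (r - 2) * k = r * (k * (k + 1)) - 2 * k\<close>.\<close>
  with two_times_polygonal[of "int r + 2" "- int k"] show ?thesis
    by (simp add: algebra_simps power2_eq_square)
qed

text \<open>Bounds the \<open>k\<close> whose trimmed staircase fits into a partition of
  \<open>n\<close>, so that the series has finite support. The \<open>+ 1\<close> is sharp: for
  \<open>r = k = 1\<close> the trimmed staircase is empty.\<close>

lemma sum_trimmed_staircase_ge:
  assumes "r \<ge> 1"
  shows "k \<le> sum_mset (trimmed_staircase r k) + 1"
proof (cases k)
  case (Suc j)
  have "1 * (k * (k + 1)) \<le> r * (k * (k + 1))"
    using assms by (intro mult_right_mono) auto
  \<comment> \<open>With \<open>k = j + 1\<close>, twice the sum is at least
    \<open>k * (k + 1) - 2 * k = j + j * j\<close>.\<close>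
  with double_sum_trimmed_staircase[OF assms, of k]
  have "j + j * j \<le> 2 * sum_mset (trimmed_staircase r k)" by (simp add: Suc)
  with le_square[of j] have "j \<le> sum_mset (trimmed_staircase r k)" by linarith
  then show ?thesis by (simp add: Suc)
qed simp

lemma zero_notin_trimmed_staircase: "0 \<notin># trimmed_staircase r k"
  by (simp add: trimmed_staircase_def count_staircase flip: count_eq_zero_iff)

text \<open>Adding and removing \<open>M\<close> are mutually inverse, and the hypothesis keeps zero
  parts out. If \<open>M\<close> has sum above \<open>n\<close>, both sides vanish, the right one by
  the convention for negative arguments.\<close>

lemma card_partitions_containing:
  assumes "0 \<notin># M"
  shows "card {\<mu> \<in> partitions n. M \<subseteq># \<mu>} = num_partitions (int n - int (sum_mset M))"
proof (cases "sum_mset M \<le> n")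
  case True
  have "bij_betw ((+) M) (partitions (n - sum_mset M)) {\<mu> \<in> partitions n. M \<subseteq># \<mu>}"
  proof (rule bij_betw_byWitness[where f' = "\<lambda>\<mu>. \<mu> - M"])
    show "(+) M ` partitions (n - sum_mset M) \<subseteq> {\<mu> \<in> partitions n. M \<subseteq># \<mu>}"
      using True assms by (auto simp: partitions_def)
    show "(\<lambda>\<mu>. \<mu> - M) ` {\<mu> \<in> partitions n. M \<subseteq># \<mu>} \<subseteq> partitions (n - sum_mset M)"
      by (auto simp: partitions_def sum_mset_diff dest: in_diffD)
  qed auto
  then have "card {\<mu> \<in> partitions n. M \<subseteq># \<mu>} = card (partitions (n - sum_mset M))"
    by (metis bij_betw_same_card)
  moreover have "nat (int n - int (sum_mset M)) = n - sum_mset M" by linarith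
  moreover have "\<not> int n - int (sum_mset M) < 0" using True by linarith
  ultimately show ?thesis by (simp only: num_partitions_def if_False)
next
  case False
  have "sum_mset M \<le> sum_mset \<mu>" if "M \<subseteq># \<mu>" for \<mu>
    using that by (auto simp: mset_subset_eq_exists_conv)
  with False have "{\<mu> \<in> partitions n. M \<subseteq># \<mu>} = {}"
    by (auto simp: partitions_def)
  moreover have "int n - int (sum_mset M) < 0" using False by linarith
  ultimately show ?thesis by (simp only: num_partitions_def if_True card.empty)
qed

lemma trimmed_staircase_subseteq_iff:
  "trimmed_staircase r k \<subseteq># \<mu> \<longleftrightarrow>
     (\<forall>i. 0 < i \<and> i < k \<longrightarrow> r \<le> count \<mu> i) \<and> (0 < k \<longrightarrow> r - 1 \<le> count \<mu> k)"
proof -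
  have "count (trimmed_staircase r k) i
      = (if 0 < i \<and> i < k then r else if 0 < i \<and> i = k then r - 1 else 0)" for i
    by (simp add: trimmed_staircase_def count_staircase Suc_le_eq)
  then show ?thesis
    unfolding subseteq_mset_def by (metis le0 less_irrefl)
qed

text \<open>Covering \<open>r = 0\<close>, where the gap is infinite and the condition on counts is
  trivial, lets this apply to \<open>gap (r - 1)\<close> at \<open>r = 1\<close>.\<close>

lemma enat_less_gap_iff:
  "enat g < gap r \<mu> \<longleftrightarrow> (\<forall>i. 0 < i \<and> i \<le> g \<longrightarrow> r \<le> count \<mu> i)"
proof (cases "r = 0")
  case False
  define P where "P i \<longleftrightarrow> 0 < i \<and> count \<mu> i < r" for i
  have "\<exists>i. P i" using gap_exists[of r \<mu>] False by (auto simp: P_def)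
  then have "g < (LEAST i. P i) \<longleftrightarrow> (\<forall>i\<le>g. \<not> P i)"
    by (metis LeastI_ex Least_le le_less_trans not_le)
  with False show ?thesis by (auto simp: gap_def P_def not_less)
qed (simp add: gap_def)

lemma trimmed_staircases_in_partition:
  assumes "r \<ge> 1"
  shows "{k. trimmed_staircase r k \<subseteq># \<mu>} =
    {..<the_enat (gap r \<mu>)} \<union> (if gap r \<mu> < gap (r - 1) \<mu> then {the_enat (gap r \<mu>)} else {})"
proof -
  obtain g where g: "gap r \<mu> = enat g"
    using assms by (auto simp: gap_def)
  have less: "j < g \<longleftrightarrow> (\<forall>i. 0 < i \<and> i \<le> j \<longrightarrow> r \<le> count \<mu> i)" for j
    using enat_less_gap_iff[of j r \<mu>] by (simp add: g)
  have "0 < g" by (simp add: less)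
  have below: "r \<le> count \<mu> i" if "0 < i" "i < g" for i
    using that less by blast
  \<comment> \<open>Otherwise \<open>1, ..., g\<close> would all occur at least \<open>r\<close>
    times, and \<open>less\<close> would give \<open>g < g\<close>.\<close>
  have at: "count \<mu> g < r"
    using below less[of g] by (metis le_neq_implies_less less_irrefl not_le)
  \<comment> \<open>The left side asks for \<open>r - 1\<close> copies of each of
    \<open>1, ..., g\<close>; below \<open>g\<close> there are even \<open>r\<close>, so only the
    part \<open>g\<close> decides.\<close>
  have drop: "gap r \<mu> < gap (r - 1) \<mu> \<longleftrightarrow> r - 1 \<le> count \<mu> g"
  proof -
    have "r - 1 \<le> count \<mu> i" if "0 < i" "i < g" for i
      using below[OF that] by simp
    with \<open>0 < g\<close> show ?thesis
      unfolding g enat_less_gap_iff by (metis le_neq_implies_less order_refl)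
  qed
  have "trimmed_staircase r k \<subseteq># \<mu> \<longleftrightarrow> k < g \<or> k = g \<and> r - 1 \<le> count \<mu> g" for k
  proof (cases k g rule: linorder_cases)
    case less
    have "r \<le> count \<mu> i" if "0 < i" "i \<le> k" for i
      using that less below by simp
    then have "trimmed_staircase r k \<subseteq># \<mu>"
      unfolding trimmed_staircase_subseteq_iff by (auto intro: le_trans[OF diff_le_self])
    with less show ?thesis by simp
  next
    case equal
    with below \<open>0 < g\<close> show ?thesis by (auto simp: trimmed_staircase_subseteq_iff)
  next
    case greater
    \<comment> \<open>For \<open>k > g\<close> the trimmed staircase contains \<open>r\<close>
      copies of \<open>g\<close>, more than \<open>\<mu>\<close> has.\<close>
    with at \<open>0 < g\<close> show ?thesis
      by (auto simp: trimmed_staircase_subseteq_iff not_le)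
  qed
  then show ?thesis unfolding drop by (auto simp: g)
qed

theorem theorem3:
  fixes n r :: nat
  assumes "r \<ge> 1"
  shows "(\<lambda>k::nat. num_partitions (int n - polygonal (int r + 2) (- int k)))
           sums (gap_sum r n + gap_drop r n)"
proof -
  define f where "f k = num_partitions (int n - polygonal (int r + 2) (- int k))" for k
  have f: "f k = card {\<mu> \<in> partitions n. trimmed_staircase r k \<subseteq># \<mu>}" for k
    unfolding f_def sum_trimmed_staircase[OF assms, symmetric]
    by (simp add: card_partitions_containing zero_notin_trimmed_staircase)
  have bound: "k \<le> n + 1" if "\<mu> \<in> partitions n" "trimmed_staircase r k \<subseteq># \<mu>" for k \<mu>
  proof -
    have "sum_mset (trimmed_staircase r k) \<le> n"
      using that by (auto simp: partitions_def mset_subset_eq_exists_conv)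
    with sum_trimmed_staircase_ge[OF assms, of k] show ?thesis by simp
  qed
  have "f k = 0" if "k \<notin> {..n + 1}" for k
  proof -
    have "{\<mu> \<in> partitions n. trimmed_staircase r k \<subseteq># \<mu>} = {}"
      using that bound by blast
    then show ?thesis by (simp only: f card.empty)
  qed
  then have "f sums (\<Sum>k\<le>n + 1. f k)"
    by (intro sums_finite) auto
  also have "(\<Sum>k\<le>n + 1. f k)
      = (\<Sum>k\<le>n + 1. \<Sum>\<mu>\<in>partitions n. if trimmed_staircase r k \<subseteq># \<mu> then 1 else 0)"
    by (simp add: f sum.If_cases finite_partitions Int_def)
  also have "\<dots> = (\<Sum>\<mu>\<in>partitions n. \<Sum>k\<le>n + 1. if trimmed_staircase r k \<subseteq># \<mu> then 1 else 0)"
    by (rule sum.swap)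
  also have "\<dots> = (\<Sum>\<mu>\<in>partitions n.
      the_enat (gap r \<mu>) + (if gap r \<mu> < gap (r - 1) \<mu> then 1 else 0))"
  proof (rule sum.cong)
    fix \<mu> assume \<mu>: "\<mu> \<in> partitions n"
    have "(\<Sum>k\<le>n + 1. if trimmed_staircase r k \<subseteq># \<mu> then 1 else 0)
        = card ({..n + 1} \<inter> {k. trimmed_staircase r k \<subseteq># \<mu>})"
      by (simp add: sum.If_cases del: sum.atMost_Suc)
    \<comment> \<open>By \<open>bound\<close>, the cut-off at \<open>n + 1\<close> loses no
      staircase that fits into \<open>\<mu>\<close>.\<close>
    also have "{..n + 1} \<inter> {k. trimmed_staircase r k \<subseteq># \<mu>} = {k. trimmed_staircase r k \<subseteq># \<mu>}"
      using bound[OF \<mu>] by auto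
    \<comment> \<open>The possible extra element is the excluded endpoint of the initial segment, so
      it adds exactly 1; these ones sum to \<open>gap_drop r n\<close>.\<close>
    also have "card \<dots> = the_enat (gap r \<mu>) + (if gap r \<mu> < gap (r - 1) \<mu> then 1 else 0)"
      unfolding trimmed_staircases_in_partition[OF assms] by simp
    finally show "(\<Sum>k\<le>n + 1. if trimmed_staircase r k \<subseteq># \<mu> then 1 else 0)
        = the_enat (gap r \<mu>) + (if gap r \<mu> < gap (r - 1) \<mu> then 1 else 0)" .
  qed simp
  also have "\<dots> = gap_sum r n + gap_drop r n"
    by (simp add: sum.distrib gap_sum_def gap_drop_def sum.If_cases finite_partitions Int_def)
  finally show ?thesis unfolding f_def .
qed

end
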